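(* Let $K,L\ge 0$ be integers, let $n=K+L+1$, and let $\mu=(K+1,1^L)$. Then the family $\{\partial_S\Delta_{\mu}\}_{S\in{\cal S}}$ is linearly independent.
   Context: Polynomials are in the variables $x_1,\dots,x_n,y_1,\dots,y_n$ with coefficients in $\mathbb{Q}$. Here $\mu=(K+1,1^L)$ is the hook-shaped partition of $n=K+L+1$ with one part $K+1$ and $L$ parts $1$. Its biexponents are the pairs $(0,0),(0,1),\dots,(0,K),(1,0),\dots,(L,0)$, listed in lexicographic order as $(p_1,q_1),\dots,(p_n,q_n)$, and $$\Delta_\mu(x,y)=\det\big(x_i^{p_j}y_i^{q_j}\big)_{i,j=1,\dots,n}.$$ Drawings with crosses (the set ${\cal D}$). There are $n-1=K+L$ places numbered $1,\dots,n-1$ from left to right along an axis. A drawing puts at each place one column: $K$ of the places carry a $y$-column (above the axis) and the other $L$ places carry an $x$-column (below the axis), the two types being interleaved in any way. From left to right the $y$-columns have heights $K,K-1,\dots,1$ and the $x$-columns have depths $L,L-1,\dots,1$ (a column of height or depth $h$ consists of $h$ cells). Each cell either contains a cross or is white; only the number of crosses in each column matters, i.e. two drawings with the same columns and the same number of crosses in each column are identified. The numbers of crosses are subject to: (1) in an $x$-column the number of crosses is arbitrary (between $0$ and its depth); (2) for a $y$-column with no $x$-column to its right, the number of crosses is arbitrary (between $0$ and its height). For a $y$-column having an $x$-column to its right, consider the first (nearest) $x$-column to its right which is uniform, meaning all its cells are crossed or all its cells are white (it exists, since the $x$-column of depth $1$ is uniform): if that $x$-column is all white, the $y$-column must contain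 at least one cross; if it is all crossed, the $y$-column must contain at least one white cell. ${\cal D}$ is the set of all drawings with crosses satisfying these rules. For $D\in{\cal D}$, $S$ denotes the collection of crossed cells of $D$, recorded as the number $a_i$ of crossed $x$-cells and the number $b_i$ of crossed $y$-cells at each place $i$ ($1\le i\le n-1$). ${\cal S}$ is the set of all $S$ obtained from $D\in{\cal D}$, and $\partial_S=\prod_{i=1}^{n-1}\partial_{x_i}^{a_i}\partial_{y_i}^{b_i}$. *)

theory Defs
  imports "HOL-Library.Poly_Mapping" "Jordan_Normal_Form.Determinant"
begin

text \<open>Indices start at 0 throughout: the \<open>n\<close> pairs of variables are \<open>X i\<close>, \<open>Y i\<close> with \<open>i < n\<close>,
  and the \<open>n - 1\<close> places of a drawing are the \<open>i < n - 1\<close>.\<close>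

datatype var = X nat | Y nat

text \<open>A polynomial is the finitely supported map sending each monomial, itself a finitely
  supported exponent function, to its coefficient; the multiplication of
  \<^theory>\<open>HOL-Library.Poly_Mapping\<close> is then the product of polynomials.\<close>

type_synonym monom = "var \<Rightarrow>\<^sub>0 nat"
type_synonym qpoly = "monom \<Rightarrow>\<^sub>0 rat"

definition pvar :: "var \<Rightarrow> qpoly" where
  "pvar v = Poly_Mapping.single (Poly_Mapping.single v 1) 1"

definition pscale :: "rat \<Rightarrow> qpoly \<Rightarrow> qpoly" where
  "pscale c p = Poly_Mapping.single 0 c * p"

definition partial :: "var \<Rightarrow> qpoly \<Rightarrow> qpoly" where
  "partial v p = (\<Sum>m\<in>Poly_Mapping.keys p. Poly_Mapping.single (m - Poly_Mapping.single v 1)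
                                 (of_nat (Poly_Mapping.lookup m v) * Poly_Mapping.lookup p m))"

lemma lookup_partial:
  "Poly_Mapping.lookup (partial v p) m =
    of_nat (Poly_Mapping.lookup m v + 1) * Poly_Mapping.lookup p (m + Poly_Mapping.single v 1)"
proof -
  let ?e = "Poly_Mapping.single v (1::nat)"
  let ?t = "\<lambda>k. of_nat (Poly_Mapping.lookup k v) * Poly_Mapping.lookup p k"
  have iff: "k - ?e = m \<longleftrightarrow> k = m + ?e" if "Poly_Mapping.lookup k v \<noteq> 0" for k
  proof
    assume m: "k - ?e = m"
    show "k = m + ?e"
      unfolding m [symmetric] using that
      by (intro poly_mapping_eqI) (auto simp: lookup_add lookup_minus lookup_single when_def)
  qed simp
  have "Poly_Mapping.lookup (partial v p) m =
    (\<Sum>k\<in>Poly_Mapping.keys p. ?t k when k - ?e = m)"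
    by (simp add: partial_def lookup_sum lookup_single)
  also have "\<dots> = (\<Sum>k\<in>Poly_Mapping.keys p. if k = m + ?e then ?t k else 0)"
  proof (intro sum.cong refl)
    fix k
    show "(?t k when k - ?e = m) = (if k = m + ?e then ?t k else 0)"
      using iff [of k] by (cases "Poly_Mapping.lookup k v = 0") (auto simp: when_def)
  qed
  also have "\<dots> = ?t (m + ?e)"
    by (auto simp: sum.delta in_keys_iff)
  finally show ?thesis
    by (simp add: lookup_add)
qed

global_interpretation qpoly: vector_space pscale
  by standard
    (simp_all add: pscale_def distrib_left distrib_right single_add mult_single
      mult.assoc [symmetric])

definition lin_indep_family :: "('i \<Rightarrow> qpoly) \<Rightarrow> 'i set \<Rightarrow> bool" where
  "lin_indep_family f I \<longleftrightarrow> inj_on f I \<and> qpoly.independent (f ` I)"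

lemma lin_indep_family_iff:
  assumes "finite I"
  shows "lin_indep_family f I \<longleftrightarrow>
    (\<forall>c. (\<Sum>i\<in>I. pscale (c i) (f i)) = 0 \<longrightarrow> (\<forall>i\<in>I. c i = 0))"
proof
  assume "lin_indep_family f I"
  then have inj: "inj_on f I" and ind: "qpoly.independent (f ` I)"
    by (auto simp: lin_indep_family_def)
  show "\<forall>c. (\<Sum>i\<in>I. pscale (c i) (f i)) = 0 \<longrightarrow> (\<forall>i\<in>I. c i = 0)"
  proof (intro allI impI ballI)
    fix c i assume sum0: "(\<Sum>i\<in>I. pscale (c i) (f i)) = 0" and i: "i \<in> I"
    let ?u = "\<lambda>v. c (inv_into I f v)"
    have "(\<Sum>v\<in>f ` I. pscale (?u v) v) = (\<Sum>i\<in>I. pscale (c i) (f i))"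
      using inj by (simp add: sum.reindex)
    then have "?u (f i) = 0"
      using ind sum0 i assms qpoly.independentD [of "f ` I" "f ` I" ?u "f i"] by simp
    then show "c i = 0" using inj i by simp
  qed
next
  assume *: "\<forall>c. (\<Sum>i\<in>I. pscale (c i) (f i)) = 0 \<longrightarrow> (\<forall>i\<in>I. c i = 0)"
  have inj: "inj_on f I"
  proof (rule inj_onI, rule ccontr)
    fix i j assume ij: "i \<in> I" "j \<in> I" "f i = f j" "i \<noteq> j"
    let ?c = "\<lambda>k. (if k = i then 1 else 0) - (if k = j then 1 else (0::rat))"
    have "(\<Sum>k\<in>I. pscale (?c k) (f k)) =
      (\<Sum>k\<in>I. if k = i then f k else 0) - (\<Sum>k\<in>I. if k = j then f k else 0)"
      unfolding sum_subtractf [symmetric]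
      by (intro sum.cong refl) (auto simp: qpoly.scale_left_diff_distrib)
    also have "\<dots> = 0" using ij assms by simp
    finally have "?c i = 0" using * [rule_format, of ?c i] ij by blast
    with ij show False by simp
  qed
  moreover have "qpoly.independent (f ` I)"
    unfolding qpoly.dependent_finite [OF finite_imageI [OF assms]]
    using * inj by (auto simp: sum.reindex)
  ultimately show "lin_indep_family f I" by (simp add: lin_indep_family_def)
qed

definition hook_biexponents :: "nat \<Rightarrow> nat \<Rightarrow> (nat \<times> nat) list" where
  "hook_biexponents K L = map (\<lambda>q. (0, q)) [0..<K + 1] @ map (\<lambda>p. (p, 0)) [1..<L + 1]"

definition hook_Delta :: "nat \<Rightarrow> nat \<Rightarrow> qpoly" where
  "hook_Delta K L =
    (let n = K + L + 1; e = hook_biexponents K L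
     in det (mat n n (\<lambda>(i, j). pvar (X i) ^ fst (e ! j) * pvar (Y i) ^ snd (e ! j))))"

text \<open>A drawing is the list of its columns from left to right; a column records its type and
  its number of crosses. Its size (depth or height) is determined by its position.\<close>

datatype column = is_XCol: XCol (crosses: nat) | is_YCol: YCol (crosses: nat)

definition x_places :: "column list \<Rightarrow> nat set" where
  "x_places D = {i. i < length D \<and> is_XCol (D ! i)}"

definition y_places :: "column list \<Rightarrow> nat set" where
  "y_places D = {i. i < length D \<and> is_YCol (D ! i)}"

definition col_size :: "nat \<Rightarrow> nat \<Rightarrow> column list \<Rightarrow> nat \<Rightarrow> nat" where
  "col_size K L D i = (if i \<in> x_places D then L - card {j \<in> x_places D. j < i}
                       else K - card {j \<in> y_places D. j < i})"

definition all_white :: "column list \<Rightarrow> nat \<Rightarrow> bool" where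
  "all_white D i \<longleftrightarrow> crosses (D ! i) = 0"

definition all_crossed :: "nat \<Rightarrow> nat \<Rightarrow> column list \<Rightarrow> nat \<Rightarrow> bool" where
  "all_crossed K L D i \<longleftrightarrow> crosses (D ! i) = col_size K L D i"

definition uniform_x :: "nat \<Rightarrow> nat \<Rightarrow> column list \<Rightarrow> nat \<Rightarrow> bool" where
  "uniform_x K L D j \<longleftrightarrow> j \<in> x_places D \<and> (all_white D j \<or> all_crossed K L D j)"

definition next_uniform_x :: "nat \<Rightarrow> nat \<Rightarrow> column list \<Rightarrow> nat \<Rightarrow> nat \<Rightarrow> bool" where
  "next_uniform_x K L D i j \<longleftrightarrow>
    i < j \<and> uniform_x K L D j \<and> (\<forall>k. i < k \<and> k < j \<longrightarrow> \<not> uniform_x K L D k)"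

text \<open>The last condition is vacuous exactly for the y-columns with no x-column to their right,
  since the rightmost x-column has depth 1 and is therefore uniform.\<close>

definition drawings :: "nat \<Rightarrow> nat \<Rightarrow> column list set" where
  "drawings K L = {D. length D = K + L \<and> card (y_places D) = K \<and> card (x_places D) = L \<and>
     (\<forall>i < K + L. crosses (D ! i) \<le> col_size K L D i) \<and>
     (\<forall>i \<in> y_places D. \<forall>j. next_uniform_x K L D i j \<longrightarrow>
        (all_white D j \<longrightarrow> crosses (D ! i) \<ge> 1) \<and>
        (all_crossed K L D j \<longrightarrow> crosses (D ! i) < col_size K L D i))}"

text \<open>The pair \<open>(a, b)\<close> of the numbers of crossed x-cells and y-cells at each place.\<close>

definition crossed_cells :: "column list \<Rightarrow> (nat \<Rightarrow> nat) \<times> (nat \<Rightarrow> nat)" where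
  "crossed_cells D = (\<lambda>i. if i \<in> x_places D then crosses (D ! i) else 0,
                      \<lambda>i. if i \<in> y_places D then crosses (D ! i) else 0)"

definition cross_sets :: "nat \<Rightarrow> nat \<Rightarrow> ((nat \<Rightarrow> nat) \<times> (nat \<Rightarrow> nat)) set" where
  "cross_sets K L = crossed_cells ` drawings K L"

definition partial_S :: "nat \<Rightarrow> (nat \<Rightarrow> nat) \<times> (nat \<Rightarrow> nat) \<Rightarrow> qpoly \<Rightarrow> qpoly" where
  "partial_S N S = foldr (\<lambda>i. (partial (X i) ^^ fst S i) \<circ> (partial (Y i) ^^ snd S i)) [0..<N]"

end

theory Submission
  imports Defs "HOL-Library.List_Lexorder"
begin

text \<open>The proof is a triangularity argument. Since the biexponents of the hook are distinct, the
  \<open>n!\<close> terms of the determinant are distinct monomials, so a monomial \<open>m\<close> occurs in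
  \<open>\<partial>\<^sub>S \<Delta>\<close> exactly when \<open>m\<close> times the monomial of the crossed cells of \<open>S\<close> is a term of \<open>\<Delta>\<close>. To a
  drawing \<open>D\<close> belongs the monomial of its white cells. It occurs in the derivative by the crosses of
  \<open>D\<close> itself, because crossed and white cells together fill the columns, whose sizes are the
  biexponents in decreasing order (and the last pair of variables gets \<open>(0, 0)\<close>). The point is
  to order the drawings so that the white cells of \<open>D\<close> occur in the derivative by the crosses of
  another drawing \<open>D'\<close> only if \<open>D'\<close> is smaller. Then in a linear relation the smallest
  drawing with nonzero coefficient contradicts the coefficient of its white monomial.

  So let the crosses of \<open>D'\<close> and the white cells of \<open>D\<close> together form a term \<open>P\<close> of the
  determinant, and read the places from left to right. At the first place \<open>D\<close> has a column of
  the largest size of its type. If \<open>D'\<close> has a column of the same type, it has at most as many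
  crosses as \<open>D\<close>, and with equality \<open>P\<close> uses up the largest exponent. If the types differ, a
  column of \<open>P\<close>, which has only one type, cannot receive both a cross of \<open>D'\<close> and a white cell of
  \<open>D\<close>. So \<open>D'\<close> is blank there or \<open>D\<close> is fully crossed, and this is a descent except in
  two ties: both columns blank, or both fully crossed. After a blank tie the two drawings have
  different numbers of columns of each type left. But in the drawing with the blank y-column the
  next uniform x-column is crossed, by the defining rule, and the same rule then excludes a fully
  crossed y-column before it; dually after a crossed tie. Carrying this information along, in a
  \<open>frame\<close>, makes the same comparison possible at every later place. The resulting sequence of
  comparison values is \<open>rank\<close>, and drawings are ordered lexicographically by it. The combinatorial heart is
  \<open>rank_linked\<close>, proved by induction on the words from the one-place comparisons
  \<open>linked_step_XX\<close>, \<open>linked_step_YY\<close>, \<open>linked_step_XY\<close> and \<open>linked_step_YX\<close>.\<close>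

section \<open>Admissible words and their ranks\<close>

text \<open>The first uniform x-column of a word whose first x-column has depth \<open>l\<close>: \<open>Some False\<close> if it
  is white, \<open>Some True\<close> if it is crossed.\<close>
fun nearest_uniform :: "nat \<Rightarrow> column list \<Rightarrow> bool option" where
  "nearest_uniform l [] = None"
| "nearest_uniform l (XCol a # D) =
    (if a = 0 then Some False else if a = l then Some True else nearest_uniform (l - 1) D)"
| "nearest_uniform l (YCol b # D) = nearest_uniform l D"

text \<open>The defining rules of drawings as a recursion on the list of columns. Every suffix of an
  admissible word is admissible, with fewer columns, which is what the induction needs.\<close>
fun admissible :: "nat \<Rightarrow> nat \<Rightarrow> column list \<Rightarrow> bool" where
  "admissible k l [] \<longleftrightarrow> k = 0 \<and> l = 0"
| "admissible k l (XCol a # D) \<longleftrightarrow> 0 < l \<and> a \<le> l \<and> admissible k (l - 1) D"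
| "admissible k l (YCol b # D) \<longleftrightarrow> 0 < k \<and> b \<le> k \<and> admissible (k - 1) l D \<and>
    (nearest_uniform l D = Some False \<longrightarrow> 1 \<le> b) \<and> (nearest_uniform l D = Some True \<longrightarrow> b < k)"

text \<open>A term of the determinant of a hook, restricted to the places: each nonzero biexponent,
  written as a column with that many crosses, stands at exactly one place.\<close>
definition full_pattern :: "nat \<Rightarrow> nat \<Rightarrow> column list \<Rightarrow> bool" where
  "full_pattern k l P \<longleftrightarrow> distinct P \<and> set P = XCol ` {1..l} \<union> YCol ` {1..k}"

fun x_crosses :: "column \<Rightarrow> nat" where
  "x_crosses (XCol a) = a" | "x_crosses (YCol b) = 0"

fun y_crosses :: "column \<Rightarrow> nat" where
  "y_crosses (XCol a) = 0" | "y_crosses (YCol b) = b"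

text \<open>The crosses of \<open>D'\<close> and the white cells of \<open>D\<close> add up to \<open>P\<close> at every place; \<open>k\<close> and \<open>l\<close> are
  the sizes of the first columns of \<open>D\<close>.\<close>
fun fills :: "nat \<Rightarrow> nat \<Rightarrow> column list \<Rightarrow> column list \<Rightarrow> column list \<Rightarrow> bool" where
  "fills k l (c' # D') (XCol a # D) (p # P) \<longleftrightarrow>
    x_crosses c' + (l - a) = x_crosses p \<and> y_crosses c' = y_crosses p \<and> fills k (l - 1) D' D P"
| "fills k l (c' # D') (YCol b # D) (p # P) \<longleftrightarrow>
    x_crosses c' = x_crosses p \<and> y_crosses c' + (k - b) = y_crosses p \<and> fills (k - 1) l D' D P"
| "fills k l D' D P \<longleftrightarrow> D' = [] \<and> D = [] \<and> P = []"

text \<open>A frame \<open>(k, l, s, t)\<close> describes the rest of a drawing after a run of ties. The pair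
  \<open>(k, l)\<close> is a common reference for all drawings that are still tied, and the drawing itself has
  \<open>k - s - t\<close> y-columns and \<open>l + s + t\<close> x-columns left. The number \<open>t\<close> is an excess of x-columns
  that arose from blank ties where the drawing had the y-column, so that its next uniform x-column
  must be crossed; \<open>s\<close> is an excess that arose from fully crossed ties, so that the next uniform
  x-column must be white. Therefore \<open>s\<close> and \<open>t\<close> are not both positive.

  In \<open>advance\<close> a common shift of the excesses is moved into the reference whenever the number
  of crosses excludes smaller excesses. For \<open>l = 0\<close> a blank or fully crossed y-column ties only
  with a y-column, which is then removed from the reference like any other.\<close>
type_synonym frame = "nat \<times> nat \<times> nat \<times> nat"

fun advance :: "frame \<Rightarrow> column \<Rightarrow> frame" where
  "advance (k, l, s, t) (XCol a) =
    (if int a - int s < int l then (k - (s - a), l + (s - a) - 1, min a s, t)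
     else (k - (a - s - l), a - s - 1, s, t - (a - s - l)))"
| "advance (k, l, s, t) (YCol b) =
    (if l = 0 \<or> 0 < b + s \<and> b + s < k then (k - 1, l, s, t)
     else if b + s = 0 then (k, l - 1, s, t + 1)
     else (k, l - 1, s + 1, t))"

text \<open>The value compared at one place. With \<open>t = 0\<close> the number \<open>a - s\<close> is \<open>l\<close> minus the number
  of white cells, and with \<open>s = 0\<close> it is the number of crosses: the crossed ties make white
  cells the common measure, and the blank ties make crosses the common measure. The value \<open>0\<close> is
  shared by both types for the blank tie, and \<open>k + l\<close> for the crossed tie.\<close>
fun level :: "frame \<Rightarrow> column \<Rightarrow> int" where
  "level (k, l, s, t) (XCol a) =
    (if int a - int s < int l then int a - int s else int a - int s + int k)"
| "level (k, l, s, t) (YCol b) = (if b + s < k then int (b + s) else int (k + l))"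

fun rank :: "frame \<Rightarrow> column list \<Rightarrow> int list" where
  "rank f [] = []"
| "rank f (c # D) = level f c # rank (advance f c) D"

fun framed :: "frame \<Rightarrow> column list \<Rightarrow> bool" where
  "framed (k, l, s, t) D \<longleftrightarrow> (s = 0 \<or> t = 0) \<and> s + t \<le> k \<and> admissible (k - s - t) (l + s + t) D \<and>
    (0 < s \<longrightarrow> nearest_uniform (l + s + t) D = Some False) \<and>
    (0 < t \<longrightarrow> nearest_uniform (l + s + t) D = Some True)"

text \<open>The relation "the white cells of \<open>D\<close> occur in the derivative by the crosses of \<open>D'\<close>" in frames
  with excesses \<open>(s', t')\<close> and \<open>(s, t)\<close>. In a blank tie the column of the term comes
  from the white cells of \<open>D\<close>, in a crossed tie from the crosses of \<open>D'\<close>. So the exponents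
  left for the term are governed by \<open>t\<close> of \<open>D\<close> and by \<open>s'\<close> of \<open>D'\<close>.\<close>
definition linked ::
  "nat \<Rightarrow> nat \<Rightarrow> nat \<Rightarrow> nat \<Rightarrow> nat \<Rightarrow> column list \<Rightarrow> column list \<Rightarrow> column list \<Rightarrow> bool" where
  "linked k l s' s t D' D P \<longleftrightarrow> (s' = 0 \<or> t = 0) \<and> s' + t \<le> k \<and>
    full_pattern (k - s' - t) (l + s' + t) P \<and> fills (k - s - t) (l + s + t) D' D P"

lemma full_pattern_XCol:
  assumes "full_pattern k l (XCol x # P)"
  shows "1 \<le> x" "x \<le> l" "x = l \<Longrightarrow> full_pattern k (l - 1) P"
proof -
  have *: "distinct P" "XCol x \<notin> set P" "insert (XCol x) (set P) = XCol ` {1..l} \<union> YCol ` {1..k}"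
    using assms by (auto simp: full_pattern_def)
  from *(3) have "XCol x \<in> XCol ` {1..l} \<union> YCol ` {1..k}" by blast
  then show "1 \<le> x" "x \<le> l" by auto
  assume "x = l"
  with * have "set P = (XCol ` {1..l} \<union> YCol ` {1..k}) - {XCol l}" by blast
  also have "\<dots> = XCol ` {1..l - 1} \<union> YCol ` {1..k}" by (auto simp: image_iff)
  finally show "full_pattern k (l - 1) P" using * by (simp add: full_pattern_def)
qed

lemma full_pattern_YCol:
  assumes "full_pattern k l (YCol y # P)"
  shows "1 \<le> y" "y \<le> k" "y = k \<Longrightarrow> full_pattern (k - 1) l P"
proof -
  have *: "distinct P" "YCol y \<notin> set P" "insert (YCol y) (set P) = XCol ` {1..l} \<union> YCol ` {1..k}"
    using assms by (auto simp: full_pattern_def)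
  from *(3) have "YCol y \<in> XCol ` {1..l} \<union> YCol ` {1..k}" by blast
  then show "1 \<le> y" "y \<le> k" by auto
  assume "y = k"
  with * have "set P = (XCol ` {1..l} \<union> YCol ` {1..k}) - {YCol k}" by blast
  also have "\<dots> = XCol ` {1..l} \<union> YCol ` {1..k - 1}" by (auto simp: image_iff)
  finally show "full_pattern (k - 1) l P" using * by (simp add: full_pattern_def)
qed

text \<open>The last x-column has depth 1 and is uniform.\<close>
lemma nearest_uniform_exists:
  assumes "admissible k l D" "0 < l"
  shows "nearest_uniform l D \<noteq> None"
  using assms
proof (induction D arbitrary: k l)
  case (Cons c D)
  show ?case
  proof (cases c)
    case (XCol a)
    with Cons show ?thesis by (cases "l = 1") auto
  next
    case (YCol b)
    with Cons show ?thesis by auto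
  qed
qed simp

text \<open>An x-column in a frame, in the three regimes of \<open>advance\<close>. With \<open>s > 0\<close> the next uniform
  column is white, so that this x-column is not fully crossed; with \<open>t > 0\<close> it is not
  white. This excludes all cases in which the reference would become negative.\<close>
lemma framed_XCol:
  assumes "framed (k, l, s, t) (XCol a # D)"
  shows "a < s \<Longrightarrow> t = 0 \<and> framed (k - (s - a), l + (s - a) - 1, a, t) D"
    and "s \<le> a \<Longrightarrow> a - s < l \<Longrightarrow> framed (k, l - 1, s, t) D"
    and "s \<le> a \<Longrightarrow> l \<le> a - s \<Longrightarrow> s = 0 \<and> 0 < a \<and> a - l \<le> t \<and> framed (k - (a - l), a - 1, s, t - (a - l)) D"
proof -
  have A: "s = 0 \<or> t = 0" "s + t \<le> k" "0 < l + s + t" "a \<le> l + s + t" "admissible (k - s - t) (l + s + t - 1) D"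
    "0 < s \<Longrightarrow> nearest_uniform (l + s + t) (XCol a # D) = Some False"
    "0 < t \<Longrightarrow> nearest_uniform (l + s + t) (XCol a # D) = Some True"
    using assms by (auto simp del: nearest_uniform.simps)
  show "a < s \<Longrightarrow> t = 0 \<and> framed (k - (s - a), l + (s - a) - 1, a, t) D"
    using A by (auto split: if_splits)
  show "s \<le> a \<Longrightarrow> a - s < l \<Longrightarrow> framed (k, l - 1, s, t) D"
    using A by (auto split: if_splits)
  assume "s \<le> a" "l \<le> a - s"
  have [simp]: "s = 0"
  proof (rule ccontr)
    assume "s \<noteq> 0"
    with A(1,4) \<open>s \<le> a\<close> \<open>l \<le> a - s\<close> have "0 < a" "a = l + s + t" by auto
    with A(6) \<open>s \<noteq> 0\<close> show False by simp
  qed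
  have "0 < a" using A \<open>l \<le> a - s\<close> by (cases "a = 0") (auto split: if_splits)
  have e: "a - l \<le> t" using A \<open>l \<le> a - s\<close> by auto
  obtain e t2 where "a = l + e" "t = e + t2"
    using e \<open>l \<le> a - s\<close> \<open>s = 0\<close> by (metis diff_zero le_Suc_ex le_add_diff_inverse)
  with A(2) \<open>0 < a\<close> have E: "k - (a - l) - s - (t - (a - l)) = k - s - t"
    "a - 1 + s + (t - (a - l)) = l + s + t - 1" "s + (t - (a - l)) \<le> k - (a - l)"
    by (simp_all, linarith)
  have "nearest_uniform (l + s + t - 1) D = Some True" if "0 < t - (a - l)"
    using A(7) that \<open>0 < a\<close> by (auto split: if_splits)
  then have "framed (k - (a - l), a - 1, s, t - (a - l)) D"
    unfolding framed.simps E(1,2) using A(5) E(3) by auto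
  with e \<open>0 < a\<close> \<open>s = 0\<close> show "s = 0 \<and> 0 < a \<and> a - l \<le> t \<and> framed (k - (a - l), a - 1, s, t - (a - l)) D"
    by blast
qed

text \<open>A positive \<open>s\<close> forbids a blank y-column and a positive \<open>t\<close> a fully crossed one, since their
  next uniform x-column has the wrong colour. Conversely a blank y-column forces the next
  uniform x-column to be crossed, and so may increase \<open>t\<close>; dually for \<open>s\<close>.\<close>
lemma framed_YCol:
  assumes "framed (k, l, s, t) (YCol b # D)"
  shows "s + t < k" "b + s + t \<le> k" "0 < s \<Longrightarrow> 0 < b" "0 < t \<Longrightarrow> b + s + t < k"
    "framed (k - 1, l, s, t) D"
    "0 < l \<Longrightarrow> b + s = 0 \<Longrightarrow> framed (k, l - 1, s, t + 1) D"
    "0 < l \<Longrightarrow> b + s = k \<Longrightarrow> framed (k, l - 1, s + 1, t) D"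
proof -
  have A: "s = 0 \<or> t = 0" "s + t < k" "b + s + t \<le> k" "admissible (k - s - t - 1) (l + s + t) D"
    "0 < s \<Longrightarrow> nearest_uniform (l + s + t) D = Some False"
    "0 < t \<Longrightarrow> nearest_uniform (l + s + t) D = Some True"
    "nearest_uniform (l + s + t) D = Some False \<Longrightarrow> 1 \<le> b"
    "nearest_uniform (l + s + t) D = Some True \<Longrightarrow> b < k - s - t"
    using assms by auto
  have B: "0 < l \<Longrightarrow> nearest_uniform (l + s + t) D \<noteq> None"
    using nearest_uniform_exists[OF A(4)] by auto
  show "s + t < k" "b + s + t \<le> k" "0 < s \<Longrightarrow> 0 < b" "0 < t \<Longrightarrow> b + s + t < k"
    using A by auto
  show "framed (k - 1, l, s, t) D" using A by (auto simp: diff_commute)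
  show "framed (k, l - 1, s, t + 1) D" if l: "0 < l" and b: "b + s = 0"
  proof -
    have "nearest_uniform (l + s + t) D = Some True"
      using A(7) B[OF l] b by (cases "nearest_uniform (l + s + t) D") (force, metis add_is_0 not_one_le_zero)
    with A l b show ?thesis by auto
  qed
  show "0 < l \<Longrightarrow> b + s = k \<Longrightarrow> framed (k, l - 1, s + 1, t) D"
    using A B by (auto)
qed

lemma framed_advance:
  assumes "framed f (c # D)"
  shows "framed (advance f c) D"
proof -
  obtain k l s t where f: "f = (k, l, s, t)" by (metis prod_cases4)
  show ?thesis
  proof (cases c)
    case (XCol a)
    note F = framed_XCol[OF assms[unfolded f XCol]]
    consider "a < s" | "s \<le> a" "a - s < l" | "s \<le> a" "l \<le> a - s" by linarith
    then show ?thesis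
    proof cases
      case 1
      with F(1) show ?thesis by (auto simp: f XCol min_def simp del: framed.simps)
    next
      case 2
      then have "int a - int s < int l" by linarith
      with F(2)[OF 2] 2 show ?thesis by (auto simp: f XCol min_def simp del: framed.simps)
    next
      case 3
      then have "\<not> int a - int s < int l" by linarith
      with F(3)[OF 3] 3 show ?thesis by (auto simp: f XCol simp del: framed.simps)
    qed
  next
    case (YCol b)
    note F = framed_YCol[OF assms[unfolded f YCol]]
    show ?thesis using F by (auto simp: f YCol simp del: framed.simps)
  qed
qed

section \<open>Comparison of two drawings\<close>

text \<open>The outcome of the comparison at one place: a strict descent, or a tie after which the rests
  are again linked over a common reference. The last conjunct makes the first columns and the
  frames recoverable from the new frames, so that equality of the rests forces equality.\<close>
definition descends :: "frame \<Rightarrow> frame \<Rightarrow> column list \<Rightarrow> column list \<Rightarrow> column list \<Rightarrow> bool" where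
  "descends f' f D' D P \<longleftrightarrow> level f' (hd D') < level f (hd D) \<or>
    level f' (hd D') = level f (hd D) \<and>
    (\<exists>k l s' t' s t. advance f' (hd D') = (k, l, s', t') \<and> advance f (hd D) = (k, l, s, t) \<and>
      linked k l s' s t (tl D') (tl D) (tl P) \<and> (s' = s \<and> t' = t \<longrightarrow> hd D' = hd D \<and> f' = f))"

lemma descends_strict: "level f' c' < level f c \<Longrightarrow> descends f' f (c' # D') (c # D) P"
  by (simp add: descends_def)

lemma descends_tie:
  assumes "level f' c' = level f c" "advance f' c' = (k, l, s', t')" "advance f c = (k, l, s, t)"
    "linked k l s' s t D' D P" "s' = s \<Longrightarrow> t' = t \<Longrightarrow> c' = c \<and> f' = f"
  shows "descends f' f (c' # D') (c # D) (p # P)"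
  using assms by (auto simp: descends_def)

text \<open>The x-exponent of the term at this place is at most the largest one left, \<open>l + s' + t\<close>. This
  is the inequality \<open>a' - s' \<le> a - s\<close>, and equality means that the largest exponent is used.\<close>
lemma linked_step_XX:
  assumes F': "framed (k, l, s', t') (XCol a' # D')" and F: "framed (k, l, s, t) (XCol a # D)"
    and L: "linked k l s' s t (XCol a' # D') (XCol a # D) (p # P)"
  shows "descends (k, l, s', t') (k, l, s, t) (XCol a' # D') (XCol a # D) (p # P)"
proof -
  from L have st: "s' = 0 \<or> t = 0" "s' + t \<le> k" and
    FP: "full_pattern (k - s' - t) (l + s' + t) (p # P)" and
    E: "a' + (l + s + t - a) = x_crosses p" "y_crosses p = 0" and
    fl: "fills (k - s - t) (l + s + t - 1) D' D P"
    by (auto simp: linked_def)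
  from E(2) FP obtain x where p: "p = XCol x"
    using full_pattern_YCol(1) by (cases p) fastforce+
  note X = full_pattern_XCol[OF FP[unfolded p]]
  have al: "a \<le> l + s + t" "s = 0 \<or> t = 0" "s + t \<le> k" using F by auto
  have al': "a' \<le> l + s' + t'" "s' = 0 \<or> t' = 0" "s' + t' \<le> k" using F' by auto
  have le: "int a' - int s' \<le> int a - int s" using E(1) p X(2) al by simp
  show ?thesis
  proof (cases "int a' - int s' = int a - int s")
    case False
    with le show ?thesis by (intro descends_strict) auto
  next
    case eq: True
    then have "x = l + s' + t" using E(1) p al by simp
    note FP' = X(3)[OF this]
    consider "a < s" | "s \<le> a" "a - s < l" | "s \<le> a" "l \<le> a - s" by linarith
    then show ?thesis
    proof cases
      case 1
      with framed_XCol(1)[OF F] have t: "t = 0" by blast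
      \<comment> \<open>Here \<open>s\<close> and \<open>s'\<close> exceed \<open>a\<close> and \<open>a'\<close> by the same amount, which moves into the reference.\<close>
      from 1 eq have h: "a' < s'" "s' - a' = s - a" by linarith+
      with framed_XCol(1)[OF F'] have t': "t' = 0" by blast
      from 1 have "int a - int s < int l" by linarith
      moreover have "k - (s - a) - a' - t = k - s' - t" "l + (s - a) - 1 + a' + t = l + s' + t - 1"
        "k - (s - a) - a - t = k - s - t" "l + (s - a) - 1 + a + t = l + s + t - 1" "a' + t \<le> k - (s - a)"
        using 1 h t st al al' by linarith+
      then have "linked (k - (s - a)) (l + (s - a) - 1) a' a t D' D P"
        using FP' fl t by (simp only: linked_def) simp
      ultimately show ?thesis
        using 1 h eq t t'
        by (intro descends_tie[where s' = a' and s = a and t' = 0 and t = 0]) (auto simp: min_def)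
    next
      case 2
      then have c: "int a - int s < int l" by linarith
      from 2 eq have i: "s' \<le> a'" "a' - s' = a - s" by linarith+
      have "linked k (l - 1) s' s t D' D P"
        using FP' fl 2 st al by (auto simp: linked_def)
      with c 2 i eq show ?thesis by (intro descends_tie) (auto simp: min_def)
    next
      case 3
      then have c: "\<not> int a - int s < int l" by linarith
      from 3 eq have g: "s' \<le> a'" "a' - s' = a - s" by linarith+
      with 3 have gg: "l \<le> a' - s'" by simp
      \<comment> \<open>More than \<open>l\<close> crosses need an excess of at least \<open>a - l\<close> on both sides, and this part of
        \<open>t\<close> and \<open>t'\<close> moves into the reference; for \<open>a = l\<close> nothing moves.\<close>
      have H: "s = 0" "0 < a" "a - l \<le> t" "s' = 0"
        using framed_XCol(3)[OF F 3] framed_XCol(3)[OF F' g(1) gg] by blast+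
      with eq have G: "s = 0" "0 < a" "a - l \<le> t" "s' = 0" "a' = a" by simp_all
      obtain e t2 where "a = l + e" "t = e + t2"
        using G 3 by (metis diff_zero le_Suc_ex le_add_diff_inverse)
      with st(2) G
      have "k - (a - l) - s' - (t - (a - l)) = k - s' - t" "a - 1 + s' + (t - (a - l)) = l + s' + t - 1"
        "k - (a - l) - s - (t - (a - l)) = k - s - t" "a - 1 + s + (t - (a - l)) = l + s + t - 1"
        "s' + (t - (a - l)) \<le> k - (a - l)"
        by (simp_all, linarith+)
      then have lk: "linked (k - (a - l)) (a - 1) s' s (t - (a - l)) D' D P"
        using FP' fl G(4) unfolding linked_def by simp
      have "a - l \<le> t'" using framed_XCol(3)[OF F' g(1) gg] G by blast
      then have "t' - (a - l) = t - (a - l) \<Longrightarrow> t' = t" using G(3) by linarith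
      then show ?thesis
        by (intro descends_tie[OF _ _ _ lk, where t' = "t' - (a - l)"]) (use G c in simp_all)
    qed
  qed
qed

text \<open>As for two x-columns, with the largest y-exponent left, \<open>k - s' - t\<close>; equality is
  either an ordinary tie or one of the two ties that change the excess, here on both sides.\<close>
lemma linked_step_YY:
  assumes F': "framed (k, l, s', t') (YCol b' # D')" and F: "framed (k, l, s, t) (YCol b # D)"
    and L: "linked k l s' s t (YCol b' # D') (YCol b # D) (p # P)"
  shows "descends (k, l, s', t') (k, l, s, t) (YCol b' # D') (YCol b # D) (p # P)"
proof -
  from L have st: "s' = 0 \<or> t = 0" "s' + t \<le> k" and
    FP: "full_pattern (k - s' - t) (l + s' + t) (p # P)" and
    E: "x_crosses p = 0" "b' + (k - s - t - b) = y_crosses p" and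
    fl: "fills (k - s - t - 1) (l + s + t) D' D P"
    by (auto simp: linked_def)
  from E(1) FP obtain y where p: "p = YCol y"
    using full_pattern_XCol(1) by (cases p) fastforce+
  note Y = full_pattern_YCol[OF FP[unfolded p]]
  note G = framed_YCol(1-4)[OF F] and G' = framed_YCol(1-4)[OF F']
  have le: "b' + s' \<le> b + s" using E(2) p Y(2) G st by simp
  show ?thesis
  proof (cases "b' + s' = b + s")
    case False
    with le G(2) show ?thesis by (intro descends_strict) auto
  next
    case eq: True
    then have y: "y = k - s' - t" using E(2) p G by simp
    note FP' = Y(3)[OF this]
    consider "l = 0 \<or> 0 < b + s \<and> b + s < k" | "0 < l" "b + s = 0" | "0 < l" "b + s = k"
      using G by linarith
    then show ?thesis
    proof cases
      case 1
      have "linked (k - 1) l s' s t D' D P"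
        using FP' fl st y Y(1) by (auto simp: linked_def diff_commute)
      with 1 eq show ?thesis by (intro descends_tie) auto
    next
      case 2
      have "linked k (l - 1) s' s (t + 1) D' D P"
        using FP' fl st G 2 eq by (auto simp: linked_def)
      with 2 eq G show ?thesis
        by (intro descends_tie[where s = s and s' = s' and t = "t + 1" and t' = "t' + 1"]) auto
    next
      case 3
      then have t: "t = 0" using G by simp
      have "linked k (l - 1) (s' + 1) (s + 1) t D' D P"
        using FP' fl st G 3 t G' by (auto simp: linked_def)
      with 3 eq G show ?thesis by (intro descends_tie) auto
    qed
  qed
qed

text \<open>For different types the term has the type of one of the two columns. If it is an x-exponent, the
  y-column of \<open>D\<close> has no white cell, and a tie is a crossed one. If it is a y-exponent, the
  x-column of \<open>D'\<close> is blank, and a tie is a blank one. The new frames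
  differ, because the drawing with the y-column gets a positive excess of a kind that the other
  one lacks.\<close>
lemma linked_step_XY:
  assumes F': "framed (k, l, s', t') (XCol a' # D')" and F: "framed (k, l, s, t) (YCol b # D)"
    and L: "linked k l s' s t (XCol a' # D') (YCol b # D) (p # P)"
  shows "descends (k, l, s', t') (k, l, s, t) (XCol a' # D') (YCol b # D) (p # P)"
proof -
  from L have st: "s' = 0 \<or> t = 0" "s' + t \<le> k" and
    FP: "full_pattern (k - s' - t) (l + s' + t) (p # P)" and
    E: "a' = x_crosses p" "k - s - t - b = y_crosses p" and
    fl: "fills (k - s - t - 1) (l + s + t) D' D P"
    by (auto simp: linked_def)
  note G = framed_YCol(1-4)[OF F]
  have G': "0 < a' \<and> s' = 0" if "s' \<le> a'" "l \<le> a' - s'"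
    using framed_XCol(3)[OF F' that] by auto
  show ?thesis
  proof (cases p)
    case (XCol x)
    note X = full_pattern_XCol[OF FP[unfolded XCol]]
    have "k \<le> b + s + t" using E XCol by simp
    with G have [simp]: "t = 0" and b: "b + s = k" by (cases "t = 0"; simp)+
    show ?thesis
    proof (cases "int a' - int s' < int l")
      case True
      with b show ?thesis by (intro descends_strict) auto
    next
      case False
      then have "s' \<le> a'" "l \<le> a' - s'" by linarith+
      with G' have [simp]: "s' = 0" "a' = l" "0 < l" using E(1) XCol X by auto
      have "linked k (l - 1) 0 (s + 1) 0 D' D P"
        using X fl E(1) XCol b G by (auto simp: linked_def)
      with False b G show ?thesis by (intro descends_tie) auto
    qed
  next
    case (YCol y)
    note Y = full_pattern_YCol[OF FP[unfolded YCol]]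
    have [simp]: "a' = 0" and b: "s' \<le> b + s" "b + s < k" using E YCol Y(1,2) st G by auto
    have c: "- int s' < int l" using G' by force
    show ?thesis
    proof (cases "b + s = 0")
      case False
      with b c show ?thesis by (intro descends_strict) auto
    next
      case True
      then have [simp]: "s' = 0" "s = 0" "b = 0" and l: "0 < l" using b c by auto
      have "t' = 0" using F' by auto
      have "y = k - s' - t" using E YCol by simp
      note FP' = Y(3)[OF this]
      have "linked k (l - 1) 0 0 (t + 1) D' D P"
        using FP' fl G l by (auto simp: linked_def)
      with b l \<open>t' = 0\<close> show ?thesis by (intro descends_tie) auto
    qed
  qed
qed

text \<open>The same with the two types exchanged; now \<open>D'\<close> has the y-column and gets the excess.\<close>
lemma linked_step_YX:
  assumes F': "framed (k, l, s', t') (YCol b' # D')" and F: "framed (k, l, s, t) (XCol a # D)"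
    and L: "linked k l s' s t (YCol b' # D') (XCol a # D) (p # P)"
  shows "descends (k, l, s', t') (k, l, s, t) (YCol b' # D') (XCol a # D) (p # P)"
proof -
  from L have st: "s' = 0 \<or> t = 0" "s' + t \<le> k" and
    FP: "full_pattern (k - s' - t) (l + s' + t) (p # P)" and
    E: "l + s + t - a = x_crosses p" "b' = y_crosses p" and
    fl: "fills (k - s - t) (l + s + t - 1) D' D P"
    by (auto simp: linked_def)
  note G' = framed_YCol(1-4)[OF F']
  have G: "0 < a \<and> s = 0" if "s \<le> a" "l \<le> a - s"
    using framed_XCol(3)[OF F that] by auto
  have al: "a \<le> l + s + t" "0 < l + s + t" "s = 0 \<or> t = 0" "s + t \<le> k" using F by auto
  show ?thesis
  proof (cases p)
    case (XCol x)
    note X = full_pattern_XCol[OF FP[unfolded XCol]]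
    have [simp]: "b' = 0" "s' = 0" using E XCol G' by auto
    have as: "s \<le> a" using E XCol X(2) al by auto
    show ?thesis
    proof (cases "a = s")
      case False
      with as G' show ?thesis by (intro descends_strict) auto
    next
      case [simp]: True
      have l: "0 < l" using G by force
      have "x = l + s' + t" using E XCol by simp
      note FP' = X(3)[OF this]
      have "linked k (l - 1) 0 s t D' D P"
        using FP' fl st l by (auto simp: linked_def)
      moreover have "t = 0" if "s = 0" using F that by auto
      ultimately show ?thesis using l G' by (intro descends_tie) auto
    qed
  next
    case (YCol y)
    note Y = full_pattern_YCol[OF FP[unfolded YCol]]
    have a: "a = l + s + t" using E YCol al by simp
    have [simp]: "s = 0" using F a al by auto
    show ?thesis
    proof (cases "b' + s' < k")
      case True
      with a show ?thesis by (intro descends_strict) auto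
    next
      case False
      then have b: "b' + s' = k" using G' by simp
      have [simp]: "t = 0" using Y(1,2) b E YCol by simp
      have l: "0 < l" using al by simp
      have "y = k - s' - t" using E YCol b by auto
      note FP' = Y(3)[OF this]
      have "linked k (l - 1) (s' + 1) 0 0 D' D P"
        using FP' fl l a G' by (auto simp: linked_def)
      then show ?thesis using b l a G' by (intro descends_tie) auto
    qed
  qed
qed

text \<open>The first place with a strict descent decides the lexicographic comparison. If there is none,
  both words end in frames without excess, and the distinguishing part of \<open>descends\<close> shows
  backwards that all columns agree.\<close>
lemma rank_linked:
  assumes "framed (k, l, s', t') D'" "framed (k, l, s, t) D" "linked k l s' s t D' D P"
  shows "rank (k, l, s', t') D' < rank (k, l, s, t) D \<or> D' = D \<and> s' = s \<and> t' = t"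
  using assms
proof (induction D' arbitrary: k l s' t' s t D P)
  case Nil
  then have "D = []" by (cases D rule: list.exhaust; cases P; cases "hd D") (auto simp: linked_def)
  with Nil show ?case by auto
next
  case (Cons c' D')
  from Cons.prems(3) obtain c D0 p P0 where D: "D = c # D0" and P: "P = p # P0"
    by (cases D; cases P; cases "hd D") (auto simp: linked_def)
  have "descends (k, l, s', t') (k, l, s, t) (c' # D') (c # D0) (p # P0)"
    using Cons.prems unfolding D P
    by (cases c'; cases c) (blast intro: linked_step_XX linked_step_XY linked_step_YX linked_step_YY)+
  then show ?case
  proof (cases "level (k, l, s', t') c' < level (k, l, s, t) c")
    case True
    then show ?thesis by (simp add: D)
  next
    case False
    with \<open>descends _ _ _ _ _\<close> obtain k2 l2 s2' t2' s2 t2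
      where tie: "level (k, l, s', t') c' = level (k, l, s, t) c"
        "advance (k, l, s', t') c' = (k2, l2, s2', t2')" "advance (k, l, s, t) c = (k2, l2, s2, t2)"
        "linked k2 l2 s2' s2 t2 D' D0 P0"
        and same: "s2' = s2 \<and> t2' = t2 \<longrightarrow> c' = c \<and> (k, l, s', t') = (k, l, s, t)"
      unfolding descends_def list.sel by blast
    have "framed (k2, l2, s2', t2') D'" "framed (k2, l2, s2, t2) D0"
      using framed_advance[OF Cons.prems(1)] framed_advance[OF Cons.prems(2)[unfolded D]] tie by simp_all
    from Cons.IH[OF this tie(4)] tie same show ?thesis by (auto simp: D)
  qed
qed

section \<open>Drawings as admissible words\<close>
fun fully_crossed :: "nat \<Rightarrow> nat \<Rightarrow> column list \<Rightarrow> column list" where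
  "fully_crossed k l [] = []"
| "fully_crossed k l (XCol a # D) = XCol l # fully_crossed k (l - 1) D"
| "fully_crossed k l (YCol b # D) = YCol k # fully_crossed (k - 1) l D"

lemma length_fully_crossed [simp]: "length (fully_crossed k l D) = length D"
  by (induction k l D rule: fully_crossed.induct) auto

lemma full_pattern_Cons_XCol: "full_pattern k (l - 1) P \<Longrightarrow> 0 < l \<Longrightarrow> full_pattern k l (XCol l # P)"
  by (cases l) (auto simp: full_pattern_def atLeastAtMostSuc_conv)

lemma full_pattern_Cons_YCol: "full_pattern (k - 1) l P \<Longrightarrow> 0 < k \<Longrightarrow> full_pattern k l (YCol k # P)"
  by (cases k) (auto simp: full_pattern_def atLeastAtMostSuc_conv)

lemma full_pattern_fully_crossed: "admissible k l D \<Longrightarrow> full_pattern k l (fully_crossed k l D)"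
  by (induction k l D rule: fully_crossed.induct)
    (auto simp: full_pattern_Cons_XCol full_pattern_Cons_YCol, simp add: full_pattern_def)

lemma fills_nth:
  assumes "length D' = length D" "length P = length D"
    and "\<And>i. i < length D \<Longrightarrow>
      x_crosses (D' ! i) + (x_crosses (fully_crossed k l D ! i) - x_crosses (D ! i)) = x_crosses (P ! i) \<and>
      y_crosses (D' ! i) + (y_crosses (fully_crossed k l D ! i) - y_crosses (D ! i)) = y_crosses (P ! i)"
  shows "fills k l D' D P"
  using assms
proof (induction D arbitrary: k l D' P)
  case (Cons c D)
  then obtain c' D'' p P' where [simp]: "D' = c' # D''" "P = p # P'"
    by (metis length_Suc_conv)
  note hd = Cons.prems(3)[of 0]
  have tl: "x_crosses (D'' ! i) + (x_crosses (fully_crossed k l (c # D) ! Suc i) - x_crosses (D ! i)) = x_crosses (P' ! i) \<and>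
    y_crosses (D'' ! i) + (y_crosses (fully_crossed k l (c # D) ! Suc i) - y_crosses (D ! i)) = y_crosses (P' ! i)"
    if "i < length D" for i
    using Cons.prems(3)[of "Suc i"] that by simp
  show ?case
  proof (cases c)
    case (XCol a)
    with hd tl Cons.IH[of D'' P' k "l - 1"] Cons.prems(1,2) show ?thesis by simp
  next
    case (YCol b)
    with hd tl Cons.IH[of D'' P' "k - 1" l] Cons.prems(1,2) show ?thesis by simp
  qed
qed auto

lemma crosses_le_fully_crossed:
  assumes "admissible k l D" "i < length D"
  shows "x_crosses (D ! i) \<le> x_crosses (fully_crossed k l D ! i)" "y_crosses (D ! i) \<le> y_crosses (fully_crossed k l D ! i)"
  using assms
  by (induction k l D arbitrary: i rule: fully_crossed.induct) (auto simp: nth_Cons split: nat.splits)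

lemma x_places_Cons: "x_places (c # D) = (if is_XCol c then {0} else {}) \<union> Suc ` x_places D"
proof (rule Set.set_eqI)
  show "i \<in> x_places (c # D) \<longleftrightarrow> i \<in> (if is_XCol c then {0} else {}) \<union> Suc ` x_places D" for i
    by (cases i) (auto simp: x_places_def)
qed

lemma y_places_Cons: "y_places (c # D) = (if is_XCol c then {} else {0}) \<union> Suc ` y_places D"
proof (rule Set.set_eqI)
  show "i \<in> y_places (c # D) \<longleftrightarrow> i \<in> (if is_XCol c then {} else {0}) \<union> Suc ` y_places D" for i
    by (cases i; cases c) (auto simp: y_places_def)
qed

lemma finite_places [simp]: "finite (x_places D)" "finite (y_places D)"
  by (auto simp: x_places_def y_places_def)

lemma card_places_below_Suc:
  "card {j \<in> x_places (c # D). j < Suc i} = (if is_XCol c then 1 else 0) + card {j \<in> x_places D. j < i}"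
  "card {j \<in> y_places (c # D). j < Suc i} = (if is_XCol c then 0 else 1) + card {j \<in> y_places D. j < i}"
proof -
  have "{j \<in> x_places (c # D). j < Suc i} = (if is_XCol c then {0} else {}) \<union> Suc ` {j \<in> x_places D. j < i}"
    by (auto simp: x_places_Cons)
  then show "card {j \<in> x_places (c # D). j < Suc i} = (if is_XCol c then 1 else 0) + card {j \<in> x_places D. j < i}"
    by (auto simp: card_image card_insert_if)
  have "{j \<in> y_places (c # D). j < Suc i} = (if is_XCol c then {} else {0}) \<union> Suc ` {j \<in> y_places D. j < i}"
    by (auto simp: y_places_Cons)
  then show "card {j \<in> y_places (c # D). j < Suc i} = (if is_XCol c then 0 else 1) + card {j \<in> y_places D. j < i}"
    by (auto simp: card_image card_insert_if)
qed

lemma col_size_0: "col_size K L (XCol a # D) 0 = L" "col_size K L (YCol a # D) 0 = K"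
  by (simp_all add: col_size_def x_places_Cons)

lemma col_size_Suc:
  "col_size K L (XCol a # D) (Suc i) = col_size K (L - 1) D i"
  "col_size K L (YCol a # D) (Suc i) = col_size (K - 1) L D i"
  by (auto simp: col_size_def card_places_below_Suc) (auto simp: x_places_Cons)

lemma uniform_x_Suc:
  "uniform_x K L (XCol a # D) (Suc i) = uniform_x K (L - 1) D i"
  "uniform_x K L (YCol a # D) (Suc i) = uniform_x (K - 1) L D i"
  by (auto simp: uniform_x_def all_white_def all_crossed_def col_size_Suc x_places_Cons)

lemma next_uniform_x_Suc:
  "next_uniform_x K L (XCol a # D) (Suc i) (Suc j) = next_uniform_x K (L - 1) D i j"
  "next_uniform_x K L (YCol a # D) (Suc i) (Suc j) = next_uniform_x (K - 1) L D i j"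
proof -
  have "(\<forall>k. Suc i < k \<and> k < Suc j \<longrightarrow> Q k) \<longleftrightarrow> (\<forall>k. i < k \<and> k < j \<longrightarrow> Q (Suc k))" for Q
    by (metis Suc_less_eq Suc_less_eq2)
  then show "next_uniform_x K L (XCol a # D) (Suc i) (Suc j) = next_uniform_x K (L - 1) D i j"
    "next_uniform_x K L (YCol a # D) (Suc i) (Suc j) = next_uniform_x (K - 1) L D i j"
    unfolding next_uniform_x_def by (simp_all add: uniform_x_Suc)
qed

text \<open>The recursive search for the next uniform x-column finds the place that the definition of
  drawings refers to. The number \<open>K\<close> is arbitrary, as it has no influence on x-columns.\<close>
lemma nearest_uniform_place:
  assumes "nearest_uniform L D = Some u"
  obtains j where "uniform_x K L D j" "\<And>i. i < j \<Longrightarrow> \<not> uniform_x K L D i"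
    "if u then all_crossed K L D j else all_white D j"
  using assms
proof (induction D arbitrary: K L thesis)
  case (Cons c D)
  show ?case
  proof (cases c)
    case (XCol a)
    show ?thesis
    proof (cases "a = 0 \<or> a = L")
      case True
      with Cons.prems XCol show ?thesis
        by (intro Cons.prems(1)[of 0])
          (auto simp: uniform_x_def x_places_Cons all_white_def all_crossed_def col_size_0 split: if_splits)
    next
      case False
      with Cons.prems(2) XCol have "nearest_uniform (L - 1) D = Some u" by simp
      then obtain j where j: "uniform_x K (L - 1) D j" "\<And>i. i < j \<Longrightarrow> \<not> uniform_x K (L - 1) D i"
        "if u then all_crossed K (L - 1) D j else all_white D j"
        using Cons.IH[where L = "L - 1" and K = K] by blast
      have "\<not> uniform_x K L (c # D) i" if "i < Suc j" for i
        using that False j(2) XCol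
        by (cases i) (auto simp: uniform_x_Suc, auto simp: uniform_x_def all_white_def all_crossed_def col_size_0)
      then show ?thesis
        using j XCol by (intro Cons.prems(1)[of "Suc j"])
          (auto simp: uniform_x_Suc all_white_def all_crossed_def col_size_Suc)
    qed
  next
    case (YCol b)
    with Cons.prems(2) have "nearest_uniform L D = Some u" by simp
    then obtain j where j: "uniform_x (K - 1) L D j" "\<And>i. i < j \<Longrightarrow> \<not> uniform_x (K - 1) L D i"
      "if u then all_crossed (K - 1) L D j else all_white D j"
      using Cons.IH[where L = L and K = "K - 1"] by blast
    have "\<not> uniform_x K L (c # D) i" if "i < Suc j" for i
      using that j(2) YCol
      by (cases i) (auto simp: uniform_x_Suc, auto simp: uniform_x_def x_places_Cons)
    then show ?thesis
      using j YCol by (intro Cons.prems(1)[of "Suc j"])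
        (auto simp: uniform_x_Suc all_white_def all_crossed_def col_size_Suc)
  qed
qed simp

lemma drawings_Cons:
  assumes "c # D \<in> drawings K L"
  shows "if is_XCol c then 0 < L \<and> D \<in> drawings K (L - 1) else 0 < K \<and> D \<in> drawings (K - 1) L"
proof -
  from assms have D: "Suc (length D) = K + L" "card (y_places (c # D)) = K" "card (x_places (c # D)) = L"
    "\<And>i. i < K + L \<Longrightarrow> crosses ((c # D) ! i) \<le> col_size K L (c # D) i"
    "\<And>i j. i \<in> y_places (c # D) \<Longrightarrow> next_uniform_x K L (c # D) i j \<Longrightarrow>
      (all_white (c # D) j \<longrightarrow> crosses ((c # D) ! i) \<ge> 1) \<and>
      (all_crossed K L (c # D) j \<longrightarrow> crosses ((c # D) ! i) < col_size K L (c # D) i)"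
    by (auto simp: drawings_def)
  show ?thesis
  proof (cases c)
    case (XCol a)
    have card: "card (x_places D) = L - 1" "0 < L" "card (y_places D) = K"
      using D(2,3) XCol by (auto simp: x_places_Cons y_places_Cons card_image card_insert_if)
    have "crosses (D ! i) \<le> col_size K (L - 1) D i" if "i < K + (L - 1)" for i
      using D(4)[of "Suc i"] that XCol card by (simp add: col_size_Suc)
    moreover have "(all_white D j \<longrightarrow> crosses (D ! i) \<ge> 1) \<and>
        (all_crossed K (L - 1) D j \<longrightarrow> crosses (D ! i) < col_size K (L - 1) D i)"
      if "i \<in> y_places D" "next_uniform_x K (L - 1) D i j" for i j
      using D(5)[of "Suc i" "Suc j"] that XCol
      by (auto simp: next_uniform_x_Suc y_places_Cons all_white_def all_crossed_def col_size_Suc)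
    ultimately show ?thesis using card D(1) XCol by (auto simp: drawings_def)
  next
    case (YCol b)
    have card: "card (x_places D) = L" "0 < K" "card (y_places D) = K - 1"
      using D(2,3) YCol by (auto simp: x_places_Cons y_places_Cons card_image card_insert_if)
    have "crosses (D ! i) \<le> col_size (K - 1) L D i" if "i < (K - 1) + L" for i
      using D(4)[of "Suc i"] that YCol card by (simp add: col_size_Suc)
    moreover have "(all_white D j \<longrightarrow> crosses (D ! i) \<ge> 1) \<and>
        (all_crossed (K - 1) L D j \<longrightarrow> crosses (D ! i) < col_size (K - 1) L D i)"
      if "i \<in> y_places D" "next_uniform_x (K - 1) L D i j" for i j
      using D(5)[of "Suc i" "Suc j"] that YCol
      by (auto simp: next_uniform_x_Suc y_places_Cons all_white_def all_crossed_def col_size_Suc)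
    ultimately show ?thesis using card D(1) YCol by (auto simp: drawings_def)
  qed
qed

lemma drawings_admissible: "D \<in> drawings K L \<Longrightarrow> admissible K L D"
proof (induction D arbitrary: K L)
  case Nil
  then show ?case by (simp add: drawings_def)
next
  case (Cons c D)
  note tl = drawings_Cons[OF Cons.prems]
  from Cons.prems have size: "crosses c \<le> col_size K L (c # D) 0"
    by (auto simp: drawings_def dest!: spec[of _ 0])
  show ?case
  proof (cases c)
    case (XCol a)
    with tl size Cons.IH[of K "L - 1"] show ?thesis by (simp add: col_size_0)
  next
    case (YCol b)
    have "if u then b < K else 1 \<le> b" if "nearest_uniform L D = Some u" for u
    proof -
      from nearest_uniform_place[OF that, of "K - 1"] obtain j
        where j: "uniform_x (K - 1) L D j" "\<And>i. i < j \<Longrightarrow> \<not> uniform_x (K - 1) L D i"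
          "if u then all_crossed (K - 1) L D j else all_white D j" by blast
      have "next_uniform_x K L (c # D) 0 (Suc j)"
        using j(1,2) YCol by (auto simp: next_uniform_x_def uniform_x_Suc gr0_conv_Suc)
      moreover have "0 \<in> y_places (c # D)" using YCol by (simp add: y_places_Cons)
      ultimately have "(all_white (c # D) (Suc j) \<longrightarrow> crosses ((c # D) ! 0) \<ge> 1) \<and>
        (all_crossed K L (c # D) (Suc j) \<longrightarrow> crosses ((c # D) ! 0) < col_size K L (c # D) 0)"
        using Cons.prems unfolding drawings_def by blast
      then show ?thesis
        using j(3) YCol by (auto simp: all_white_def all_crossed_def col_size_Suc col_size_0 split: if_splits)
    qed
    from this[of True] this[of False] YCol tl size Cons.IH[of "K - 1" L]
    show ?thesis by (simp add: col_size_0)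
  qed
qed

lemma finite_drawings: "finite (drawings K L)"
proof (rule finite_subset)
  have "c \<in> XCol ` {..K + L} \<union> YCol ` {..K + L}" if "D \<in> drawings K L" "c \<in> set D" for c D
  proof -
    from that obtain i where i: "i < K + L" "c = D ! i"
      by (auto simp: drawings_def in_set_conv_nth)
    with that(1) have "crosses c \<le> col_size K L D i" by (auto simp: drawings_def)
    also have "\<dots> \<le> K + L" by (auto simp: col_size_def intro: le_trans[OF diff_le_self])
    finally show ?thesis by (cases c) auto
  qed
  then show "drawings K L \<subseteq> {D. set D \<subseteq> XCol ` {..K + L} \<union> YCol ` {..K + L} \<and> length D = K + L}"
    by (auto simp: drawings_def subset_iff)
qed (simp add: finite_lists_length_eq)

section \<open>Coefficients of the derivatives of the determinant\<close>
lemma lookup_partial_funpow: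
  "\<exists>c>0. Poly_Mapping.lookup ((partial v ^^ a) p) m =
     c * Poly_Mapping.lookup p (m + Poly_Mapping.single v a)"
proof (induction a arbitrary: m)
  case 0
  show ?case by (rule exI[of _ 1]) simp
next
  case (Suc a)
  obtain c where c: "0 < c" "Poly_Mapping.lookup ((partial v ^^ a) p) (m + Poly_Mapping.single v 1) =
     c * Poly_Mapping.lookup p (m + Poly_Mapping.single v 1 + Poly_Mapping.single v a)"
    using Suc by blast
  have "Poly_Mapping.single v 1 + Poly_Mapping.single v a = Poly_Mapping.single v (Suc a)"
    by (simp add: single_add[symmetric])
  then have "Poly_Mapping.lookup ((partial v ^^ Suc a) p) m =
    of_nat (Poly_Mapping.lookup m v + 1) * c * Poly_Mapping.lookup p (m + Poly_Mapping.single v (Suc a))"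
    using c(2) by (simp add: lookup_partial add.assoc)
  moreover have "0 < of_nat (Poly_Mapping.lookup m v + 1) * c" using c(1) by simp
  ultimately show ?case by blast
qed

text \<open>A monomial operator shifts exponents and multiplies by positive factors. Their values
  do not matter, as only the vanishing of coefficients is used.\<close>
lemma lookup_partial_S:
  "\<exists>c>0. Poly_Mapping.lookup (partial_S N S p) m = c * Poly_Mapping.lookup p
     (m + (\<Sum>i<N. Poly_Mapping.single (X i) (fst S i) + Poly_Mapping.single (Y i) (snd S i)))"
proof -
  let ?e = "\<lambda>i. Poly_Mapping.single (X i) (fst S i) + Poly_Mapping.single (Y i) (snd S i)"
  let ?d = "\<lambda>i. (partial (X i) ^^ fst S i) \<circ> (partial (Y i) ^^ snd S i)"
  have "\<exists>c>0. Poly_Mapping.lookup (foldr ?d is p) m = c * Poly_Mapping.lookup p (m + (\<Sum>i\<leftarrow>is. ?e i))" for "is"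
  proof (induction "is" arbitrary: m)
    case Nil
    show ?case by (rule exI[of _ 1]) simp
  next
    case (Cons i js)
    let ?q = "foldr ?d js p"
    obtain c where c: "0 < c" "Poly_Mapping.lookup (foldr ?d (i # js) p) m =
        c * Poly_Mapping.lookup ((partial (Y i) ^^ snd S i) ?q) (m + Poly_Mapping.single (X i) (fst S i))"
      using lookup_partial_funpow[of "fst S i" "X i" "(partial (Y i) ^^ snd S i) ?q" m] by auto
    obtain c' where c': "0 < c'" "Poly_Mapping.lookup ((partial (Y i) ^^ snd S i) ?q) (m + Poly_Mapping.single (X i) (fst S i)) =
        c' * Poly_Mapping.lookup ?q (m + ?e i)"
      using lookup_partial_funpow[of "snd S i" "Y i" ?q "m + Poly_Mapping.single (X i) (fst S i)"]
      by (auto simp: add.assoc)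
    obtain c'' where c'': "0 < c''" "Poly_Mapping.lookup ?q (m + ?e i) =
        c'' * Poly_Mapping.lookup p (m + ?e i + (\<Sum>i\<leftarrow>js. ?e i))"
      using Cons.IH by blast
    have "Poly_Mapping.lookup (foldr ?d (i # js) p) m =
        (c * c' * c'') * Poly_Mapping.lookup p (m + (\<Sum>i\<leftarrow>i # js. ?e i))"
      unfolding c(2) c'(2) c''(2) by (simp add: add.assoc mult.assoc)
    moreover have "0 < c * c' * c''" using c(1) c'(1) c''(1) by simp
    ultimately show ?case by blast
  qed
  from this[of "[0..<N]"] show ?thesis
    by (simp add: partial_S_def interv_sum_list_conv_sum_set_nat atLeast0LessThan)
qed

text \<open>The term of the determinant that belongs to a permutation, up to its sign.\<close>
definition perm_monom :: "nat \<Rightarrow> nat \<Rightarrow> (nat \<Rightarrow> nat) \<Rightarrow> monom" where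
  "perm_monom K L \<pi> = (\<Sum>i<K + L + 1.
     Poly_Mapping.single (X i) (fst (hook_biexponents K L ! \<pi> i)) +
     Poly_Mapping.single (Y i) (snd (hook_biexponents K L ! \<pi> i)))"

lemma lookup_sum_XY:
  "Poly_Mapping.lookup (\<Sum>i<N. Poly_Mapping.single (X i) (f i) + Poly_Mapping.single (Y i) (g i)) (X j) =
     (if j < N then f j else (0::nat))"
  "Poly_Mapping.lookup (\<Sum>i<N. Poly_Mapping.single (X i) (f i) + Poly_Mapping.single (Y i) (g i)) (Y j) =
     (if j < N then g j else (0::nat))"
  by (auto simp: lookup_sum lookup_add lookup_single when_def)

lemma monom_eqI:
  assumes "\<And>i. Poly_Mapping.lookup m (X i) = Poly_Mapping.lookup m' (X i)"
    "\<And>i. Poly_Mapping.lookup m (Y i) = Poly_Mapping.lookup m' (Y i)"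
  shows "m = (m' :: monom)"
proof (rule poly_mapping_eqI)
  fix v show "Poly_Mapping.lookup m v = Poly_Mapping.lookup m' v"
    using assms by (cases v) auto
qed

lemma pvar_power: "pvar v ^ a = Poly_Mapping.single (Poly_Mapping.single v a) 1"
proof (induction a)
  case (Suc a)
  then show ?case by (simp add: pvar_def mult_single single_add[symmetric])
qed simp

lemma prod_single_1:
  "finite A \<Longrightarrow> (\<Prod>i\<in>A. Poly_Mapping.single (m i) 1) = (Poly_Mapping.single (\<Sum>i\<in>A. m i) 1 :: qpoly)"
  by (induction A rule: finite_induct) (simp_all add: mult_single)

lemma hook_biexponents_nth:
  "j < K + L + 1 \<Longrightarrow> hook_biexponents K L ! j = (if j \<le> K then (0, j) else (j - K, 0))"
  by (auto simp: hook_biexponents_def nth_append simp del: upt_Suc)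

lemma lookup_hook_Delta:
  "Poly_Mapping.lookup (hook_Delta K L) m =
     (\<Sum>\<pi> | \<pi> permutes {0..<K + L + 1}. if perm_monom K L \<pi> = m then of_int (sign \<pi>) else 0)"
proof -
  let ?n = "K + L + 1" and ?e = "hook_biexponents K L"
  have sgn: "(of_int z :: qpoly) * Poly_Mapping.single m' 1 = Poly_Mapping.single m' (of_int z)" for z m'
  proof -
    have "(of_int z :: qpoly) = Poly_Mapping.single 0 (of_int z)" by simp
    then show ?thesis by (simp add: mult_single del: single_of_int)
  qed
  have "(\<Prod>i = 0..<?n. mat ?n ?n (\<lambda>(i, j). pvar (X i) ^ fst (?e ! j) * pvar (Y i) ^ snd (?e ! j)) $$ (i, \<pi> i)) =
      Poly_Mapping.single (perm_monom K L \<pi>) 1" if "\<pi> permutes {0..<?n}" for \<pi>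
  proof -
    have "(\<Prod>i = 0..<?n. mat ?n ?n (\<lambda>(i, j). pvar (X i) ^ fst (?e ! j) * pvar (Y i) ^ snd (?e ! j)) $$ (i, \<pi> i)) =
      (\<Prod>i = 0..<?n. Poly_Mapping.single (Poly_Mapping.single (X i) (fst (?e ! \<pi> i)) +
         Poly_Mapping.single (Y i) (snd (?e ! \<pi> i))) 1)"
      using permutes_in_image[OF that]
      by (intro prod.cong) (auto simp: pvar_power mult_single)
    also have "\<dots> = Poly_Mapping.single (perm_monom K L \<pi>) 1"
      unfolding perm_monom_def atLeast0LessThan by (rule prod_single_1) simp
    finally show ?thesis .
  qed
  then have "hook_Delta K L =
      (\<Sum>\<pi> | \<pi> permutes {0..<?n}. Poly_Mapping.single (perm_monom K L \<pi>) (of_int (sign \<pi>)))"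
    unfolding hook_Delta_def Let_def det_def by (simp add: sgn)
  then show ?thesis
    by (simp add: lookup_sum lookup_single when_def)
qed

text \<open>No two terms of the determinant cancel, because the biexponents are distinct.\<close>
lemma perm_monom_inj:
  assumes "\<pi> permutes {0..<K + L + 1}" "\<rho> permutes {0..<K + L + 1}" "perm_monom K L \<pi> = perm_monom K L \<rho>"
  shows "\<pi> = \<rho>"
proof
  fix i
  show "\<pi> i = \<rho> i"
  proof (cases "i < K + L + 1")
    case True
    then have lt: "\<pi> i < K + L + 1" "\<rho> i < K + L + 1"
      using assms(1,2) permutes_in_image by fastforce+
    have "fst (hook_biexponents K L ! \<pi> i) = fst (hook_biexponents K L ! \<rho> i)"
      "snd (hook_biexponents K L ! \<pi> i) = snd (hook_biexponents K L ! \<rho> i)"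
      using arg_cong[OF assms(3), of "\<lambda>m. Poly_Mapping.lookup m (X i)"]
        arg_cong[OF assms(3), of "\<lambda>m. Poly_Mapping.lookup m (Y i)"] True
      unfolding perm_monom_def lookup_sum_XY by simp_all
    then show ?thesis
      unfolding hook_biexponents_nth[OF lt(1)] hook_biexponents_nth[OF lt(2)] by (auto split: if_splits)
  next
    case False
    then show ?thesis using assms(1,2) by (simp add: permutes_def)
  qed
qed

lemma lookup_hook_Delta_nonzeroE:
  assumes "Poly_Mapping.lookup (hook_Delta K L) m \<noteq> 0"
  obtains \<pi> where "\<pi> permutes {0..<K + L + 1}" "m = perm_monom K L \<pi>"
proof -
  obtain \<pi> where "\<pi> \<in> {\<pi>. \<pi> permutes {0..<K + L + 1}}"
      "(if perm_monom K L \<pi> = m then of_int (sign \<pi>) else 0) \<noteq> (0::rat)"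
    using sum.not_neutral_contains_not_neutral[OF assms[unfolded lookup_hook_Delta]] .
  then show thesis using that by (auto split: if_splits)
qed

lemma lookup_hook_Delta_perm_monom:
  assumes "\<pi> permutes {0..<K + L + 1}"
  shows "Poly_Mapping.lookup (hook_Delta K L) (perm_monom K L \<pi>) = of_int (sign \<pi>)"
proof -
  have "Poly_Mapping.lookup (hook_Delta K L) (perm_monom K L \<pi>) =
      (\<Sum>\<rho> | \<rho> permutes {0..<K + L + 1}. if \<pi> = \<rho> then of_int (sign \<rho>) else 0)"
    unfolding lookup_hook_Delta using perm_monom_inj[OF _ assms] by (intro sum.cong) auto
  also have "\<dots> = of_int (sign \<pi>)" using assms by (simp add: finite_permutations)
  finally show ?thesis .
qed

definition cross_monom :: "column list \<Rightarrow> monom" where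
  "cross_monom D = (\<Sum>i<length D. Poly_Mapping.single (X i) (x_crosses (D ! i)) +
     Poly_Mapping.single (Y i) (y_crosses (D ! i)))"

lemma lookup_cross_monom:
  "Poly_Mapping.lookup (cross_monom D) (X i) = (if i < length D then x_crosses (D ! i) else 0)"
  "Poly_Mapping.lookup (cross_monom D) (Y i) = (if i < length D then y_crosses (D ! i) else 0)"
  unfolding cross_monom_def lookup_sum_XY by simp_all

lemma crossed_cells_crosses:
  "i < length D \<Longrightarrow> fst (crossed_cells D) i = x_crosses (D ! i) \<and> snd (crossed_cells D) i = y_crosses (D ! i)"
  by (cases "D ! i") (auto simp: crossed_cells_def x_places_def y_places_def)

lemma lookup_partial_S_crossed_cells:
  assumes "length D = N"
  shows "\<exists>c>0. Poly_Mapping.lookup (partial_S N (crossed_cells D) p) m =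
    c * Poly_Mapping.lookup p (m + cross_monom D)"
proof -
  have "(\<Sum>i<N. Poly_Mapping.single (X i) (fst (crossed_cells D) i) + Poly_Mapping.single (Y i) (snd (crossed_cells D) i))
      = cross_monom D"
    unfolding cross_monom_def assms using crossed_cells_crosses[of _ D] assms
    by (intro sum.cong) auto
  then show ?thesis using lookup_partial_S[of N "crossed_cells D" p m] by simp
qed

text \<open>If the last pair of variables gets the exponents \<open>(0, 0)\<close>, then the nonzero biexponents
  are distributed over the places, each exactly once.\<close>
lemma full_pattern_of_perm:
  assumes "\<pi> permutes {0..<K + L + 1}"
    and "Poly_Mapping.lookup (perm_monom K L \<pi>) (X (K + L)) = 0"
    and "Poly_Mapping.lookup (perm_monom K L \<pi>) (Y (K + L)) = 0"
  obtains P where "full_pattern K L P" "length P = K + L" "perm_monom K L \<pi> = cross_monom P"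
proof -
  let ?e = "hook_biexponents K L"
  \<comment> \<open>The biexponent at position \<open>j\<close> of the list is \<open>(0, j)\<close> up to \<open>j = K\<close>, then \<open>(j - K, 0)\<close>.\<close>
  define col where "col j = (if j \<le> K then YCol j else XCol (j - K))" for j
  have lt: "\<pi> i < K + L + 1" if "i < K + L + 1" for i
    using permutes_in_image[OF assms(1), of i] that by simp
  have "fst (?e ! \<pi> (K + L)) = 0" "snd (?e ! \<pi> (K + L)) = 0"
    using assms(2,3) unfolding perm_monom_def lookup_sum_XY by simp_all
  then have last: "\<pi> (K + L) = 0"
    using lt[of "K + L"] by (auto simp: hook_biexponents_nth split: if_splits)
  have inj: "inj \<pi>" using assms(1) by (rule permutes_inj)
  have "\<pi> ` {0..<K + L + 1} = {0..<K + L + 1}" using assms(1) by (rule permutes_image)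
  moreover have "\<pi> ` {0..<K + L + 1} = insert 0 (\<pi> ` {0..<K + L})"
    using last by (simp add: atLeast0_lessThan_Suc)
  moreover have "0 \<notin> \<pi> ` {0..<K + L}"
    using inj last by (metis atLeastLessThan_iff imageE injD less_irrefl)
  ultimately have "\<pi> ` {0..<K + L} = {0..<K + L + 1} - {0}" by blast
  also have "\<dots> = {1..K + L}" by auto
  finally have img: "\<pi> ` {0..<K + L} = {1..K + L}" .
  have col_img: "col ` {1..K + L} = XCol ` {1..L} \<union> YCol ` {1..K}"
  proof
    show "XCol ` {1..L} \<union> YCol ` {1..K} \<subseteq> col ` {1..K + L}"
    proof
      fix c assume "c \<in> XCol ` {1..L} \<union> YCol ` {1..K}"
      then consider x where "c = XCol x" "1 \<le> x" "x \<le> L" | y where "c = YCol y" "1 \<le> y" "y \<le> K" by auto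
      then show "c \<in> col ` {1..K + L}"
      proof cases
        case (1 x)
        then have "c = col (K + x)" "K + x \<in> {1..K + L}" by (auto simp: col_def)
        then show ?thesis by blast
      next
        case (2 y)
        then have "c = col y" "y \<in> {1..K + L}" by (auto simp: col_def)
        then show ?thesis by blast
      qed
    qed
    show "col ` {1..K + L} \<subseteq> XCol ` {1..L} \<union> YCol ` {1..K}"
    proof (rule image_subsetI)
      fix j assume "j \<in> {1..K + L}"
      then show "col j \<in> XCol ` {1..L} \<union> YCol ` {1..K}"
        by (cases "j \<le> K") (auto simp: col_def image_iff)
    qed
  qed
  have "inj_on col {1..K + L}" by (auto simp: inj_on_def col_def split: if_splits)
  then have "inj_on (\<lambda>i. col (\<pi> i)) {0..<K + L}"
    using comp_inj_on[of \<pi> "{0..<K + L}" col] inj img by (simp add: comp_def inj_on_subset)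
  then have "full_pattern K L (map (\<lambda>i. col (\<pi> i)) [0..<K + L])"
    using img col_img image_image[of col \<pi> "{0..<K + L}"] by (simp add: full_pattern_def distinct_map)
  moreover have "perm_monom K L \<pi> = cross_monom (map (\<lambda>i. col (\<pi> i)) [0..<K + L])"
  proof (rule monom_eqI)
    fix i
    have "x_crosses (col (\<pi> i)) = fst (?e ! \<pi> i)" "y_crosses (col (\<pi> i)) = snd (?e ! \<pi> i)" if "i < K + L + 1"
      using lt[OF that] by (auto simp: hook_biexponents_nth col_def)
    moreover have "fst (?e ! \<pi> (K + L)) = 0" "snd (?e ! \<pi> (K + L)) = 0"
      by (simp_all add: last hook_biexponents_nth)
    moreover have "i < K + L \<or> i = K + L \<or> K + L + 1 \<le> i" by linarith
    ultimately show "Poly_Mapping.lookup (perm_monom K L \<pi>) (X i) =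
        Poly_Mapping.lookup (cross_monom (map (\<lambda>i. col (\<pi> i)) [0..<K + L])) (X i)"
      "Poly_Mapping.lookup (perm_monom K L \<pi>) (Y i) =
        Poly_Mapping.lookup (cross_monom (map (\<lambda>i. col (\<pi> i)) [0..<K + L])) (Y i)"
      unfolding perm_monom_def lookup_sum_XY lookup_cross_monom by auto
  qed
  ultimately show thesis using that by simp
qed

lemma perm_of_full_pattern:
  assumes "full_pattern K L P" "length P = K + L"
  obtains \<pi> where "\<pi> permutes {0..<K + L + 1}" "perm_monom K L \<pi> = cross_monom P"
proof -
  let ?e = "hook_biexponents K L" and ?n = "K + L + 1"
  define idx where "idx c = (case c of XCol x \<Rightarrow> K + x | YCol y \<Rightarrow> y)" for c
  define \<pi> where "\<pi> i = (if i < K + L then idx (P ! i) else if i = K + L then 0 else i)" for i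
  have P: "distinct P" "set P = XCol ` {1..L} \<union> YCol ` {1..K}"
    using assms(1) by (auto simp: full_pattern_def)
  have idx: "idx c \<noteq> 0" "idx c < ?n"
    "x_crosses c = fst (?e ! idx c)" "y_crosses c = snd (?e ! idx c)" if "c \<in> set P" for c
    using that unfolding P(2) by (auto simp: idx_def hook_biexponents_nth)
  have idx_inj: "inj_on idx (set P)"
    unfolding P(2) by (auto simp: inj_on_def idx_def)
  have inj: "inj_on \<pi> {0..<?n}"
  proof (rule inj_onI)
    fix i j assume ij: "i \<in> {0..<?n}" "j \<in> {0..<?n}" "\<pi> i = \<pi> j"
    have idx_P: "idx (P ! i) \<noteq> 0" if "i < K + L" for i using idx(1)[of "P ! i"] that assms(2) by simp
    have idx_P_inj: "i = j" if "i < K + L" "j < K + L" "idx (P ! i) = idx (P ! j)" for i j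
      using that inj_onD[OF idx_inj that(3)] nth_eq_iff_index_eq[OF P(1)] assms(2) by simp
    have "i < K + L \<or> i = K + L" "j < K + L \<or> j = K + L" using ij by auto
    then show "i = j"
      using ij(3) idx_P[of i] idx_P[of j] idx_P_inj[of i j] by (auto simp: \<pi>_def)
  qed
  have sub: "\<pi> ` {0..<?n} \<subseteq> {0..<?n}"
    using idx(2) assms(2) by (auto simp: \<pi>_def)
  have "\<pi> permutes {0..<?n}"
    using endo_inj_surj[OF _ sub inj] inj
    by (intro bij_imp_permutes) (auto simp: bij_betw_def \<pi>_def)
  moreover have "perm_monom K L \<pi> = cross_monom P"
  proof (rule monom_eqI)
    fix i
    have "P ! i \<in> set P" if "i < K + L" using that assms(2) by simp
    moreover have "fst (?e ! 0) = 0" "snd (?e ! 0) = 0" by (simp_all add: hook_biexponents_nth)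
    moreover have "i < K + L \<or> i = K + L \<or> K + L + 1 \<le> i" by linarith
    ultimately show "Poly_Mapping.lookup (perm_monom K L \<pi>) (X i) = Poly_Mapping.lookup (cross_monom P) (X i)"
      "Poly_Mapping.lookup (perm_monom K L \<pi>) (Y i) = Poly_Mapping.lookup (cross_monom P) (Y i)"
      unfolding perm_monom_def lookup_sum_XY lookup_cross_monom using idx(3,4) assms(2)
      by (auto simp: \<pi>_def)
  qed
  ultimately show thesis using that by blast
qed

section \<open>Linear independence\<close>
definition white_monom :: "nat \<Rightarrow> nat \<Rightarrow> column list \<Rightarrow> monom" where
  "white_monom K L D = cross_monom (fully_crossed K L D) - cross_monom D"

lemma length_drawing: "D \<in> drawings K L \<Longrightarrow> length D = K + L"
  by (simp add: drawings_def)

text \<open>Crossed and white cells of a drawing fill its columns, and these form a term.\<close>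
lemma lookup_white_monom_diag:
  assumes "D \<in> drawings K L"
  shows "Poly_Mapping.lookup (partial_S (K + L) (crossed_cells D) (hook_Delta K L)) (white_monom K L D) \<noteq> 0"
proof -
  have len: "length D = K + L" and adm: "admissible K L D"
    using assms by (simp_all add: drawings_admissible length_drawing)
  have "white_monom K L D + cross_monom D = cross_monom (fully_crossed K L D)"
    by (rule monom_eqI)
      (auto simp: white_monom_def lookup_add lookup_minus lookup_cross_monom crosses_le_fully_crossed[OF adm])
  moreover obtain \<pi> where "\<pi> permutes {0..<K + L + 1}" "perm_monom K L \<pi> = cross_monom (fully_crossed K L D)"
    using perm_of_full_pattern[OF full_pattern_fully_crossed[OF adm]] len by auto
  moreover obtain c where "c > 0" "Poly_Mapping.lookup (partial_S (K + L) (crossed_cells D) (hook_Delta K L)) (white_monom K L D) =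
      c * Poly_Mapping.lookup (hook_Delta K L) (white_monom K L D + cross_monom D)"
    using lookup_partial_S_crossed_cells[OF len] by blast
  ultimately show ?thesis
    by (metis lookup_hook_Delta_perm_monom mult_eq_0_iff of_int_eq_0_iff less_irrefl sign_nz)
qed

text \<open>Crosses and white cells leave the last pair of variables untouched, so the term they add up to
  has exponents \<open>(0, 0)\<close> there and is a full pattern on the places.\<close>
lemma lookup_white_monom_offdiag:
  assumes "D' \<in> drawings K L" "D \<in> drawings K L"
    and "Poly_Mapping.lookup (partial_S (K + L) (crossed_cells D') (hook_Delta K L)) (white_monom K L D) \<noteq> 0"
  shows "rank (K, L, 0, 0) D' < rank (K, L, 0, 0) D \<or> D' = D"
proof -
  have len: "length D = K + L" "length D' = K + L" and adm: "admissible K L D" "admissible K L D'"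
    using assms(1,2) by (simp_all add: drawings_admissible length_drawing)
  obtain c where "Poly_Mapping.lookup (partial_S (K + L) (crossed_cells D') (hook_Delta K L)) (white_monom K L D) =
      c * Poly_Mapping.lookup (hook_Delta K L) (white_monom K L D + cross_monom D')"
    using lookup_partial_S_crossed_cells[OF len(2)] by blast
  with assms(3) obtain \<pi> where \<pi>: "\<pi> permutes {0..<K + L + 1}" "white_monom K L D + cross_monom D' = perm_monom K L \<pi>"
    using lookup_hook_Delta_nonzeroE[of K L "white_monom K L D + cross_monom D'"] by auto
  have sum: "Poly_Mapping.lookup (perm_monom K L \<pi>) (X i) =
      (if i < K + L then x_crosses (D' ! i) + (x_crosses (fully_crossed K L D ! i) - x_crosses (D ! i)) else 0)"
    "Poly_Mapping.lookup (perm_monom K L \<pi>) (Y i) =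
      (if i < K + L then y_crosses (D' ! i) + (y_crosses (fully_crossed K L D ! i) - y_crosses (D ! i)) else 0)" for i
    unfolding \<pi>(2)[symmetric] by (auto simp: white_monom_def lookup_add lookup_minus lookup_cross_monom len)
  obtain P where P: "full_pattern K L P" "length P = K + L" "perm_monom K L \<pi> = cross_monom P"
    using full_pattern_of_perm[OF \<pi>(1)] sum by auto
  have "fills K L D' D P"
  proof (rule fills_nth)
    fix i assume "i < length D"
    then show "x_crosses (D' ! i) + (x_crosses (fully_crossed K L D ! i) - x_crosses (D ! i)) = x_crosses (P ! i) \<and>
      y_crosses (D' ! i) + (y_crosses (fully_crossed K L D ! i) - y_crosses (D ! i)) = y_crosses (P ! i)"
      using sum[of i] P(2) len unfolding P(3) lookup_cross_monom by auto
  qed (use len P in auto)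
  with P(1) have "linked K L 0 0 0 D' D P" by (simp add: linked_def)
  with rank_linked[of K L 0 0 D' 0 0 D P] adm show ?thesis by auto
qed

theorem theorem3:
  fixes K L n :: nat
  assumes "n = K + L + 1"
  shows "lin_indep_family (\<lambda>S. partial_S (n - 1) S (hook_Delta K L)) (cross_sets K L)"
proof -
  let ?f = "\<lambda>S. partial_S (K + L) S (hook_Delta K L)"
  define d where "d = inv_into (drawings K L) crossed_cells"
  have d: "d S \<in> drawings K L" "crossed_cells (d S) = S" if "S \<in> cross_sets K L" for S
    using that unfolding cross_sets_def d_def by (auto intro: inv_into_into f_inv_into_f)
  have fin: "finite (cross_sets K L)"
    by (simp add: cross_sets_def finite_drawings)
  have "c S = 0" if sum0: "(\<Sum>S\<in>cross_sets K L. pscale (c S) (?f S)) = 0" and S: "S \<in> cross_sets K L" for c S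
  proof (rule ccontr)
    let ?r = "\<lambda>S. rank (K, L, 0, 0) (d S)" and ?N = "{S \<in> cross_sets K L. c S \<noteq> 0}"
    assume "c S \<noteq> 0"
    with S have "S \<in> ?N" by simp
    with fin have "finite ?N" "?N \<noteq> {}" by (simp, blast)
    from arg_min_if_finite[OF this, of ?r] obtain T
      where T: "T \<in> cross_sets K L" "c T \<noteq> 0" and least: "\<And>S. S \<in> ?N \<Longrightarrow> \<not> ?r S < ?r T"
      by blast
    let ?m = "white_monom K L (d T)"
    have off: "c S * Poly_Mapping.lookup (?f S) ?m = 0" if "S \<in> cross_sets K L" "S \<noteq> T" for S
    proof (rule ccontr)
      assume "c S * Poly_Mapping.lookup (?f S) ?m \<noteq> 0"
      then have "S \<in> ?N" "Poly_Mapping.lookup (?f (crossed_cells (d S))) ?m \<noteq> 0"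
        using that d by auto
      then have "d S = d T"
        using lookup_white_monom_offdiag[OF d(1)[OF that(1)] d(1)[OF T(1)]] least by blast
      with that d T show False by metis
    qed
    have "Poly_Mapping.lookup (pscale a p) m = a * Poly_Mapping.lookup p m" for a p m
      unfolding pscale_def mult_map_scale_conv_mult[symmetric] by (simp add: map.rep_eq when_def)
    then have "(\<Sum>S\<in>cross_sets K L. c S * Poly_Mapping.lookup (?f S) ?m) = 0"
      using arg_cong[OF sum0, of "\<lambda>p. Poly_Mapping.lookup p ?m"] by (simp add: lookup_sum)
    also have "(\<Sum>S\<in>cross_sets K L. c S * Poly_Mapping.lookup (?f S) ?m) = c T * Poly_Mapping.lookup (?f T) ?m"
    proof -
      have "(\<Sum>S\<in>cross_sets K L - {T}. c S * Poly_Mapping.lookup (?f S) ?m) = 0"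
        using off by (intro sum.neutral ballI) blast
      then show ?thesis
        using sum.remove[OF fin T(1), of "\<lambda>S. c S * Poly_Mapping.lookup (?f S) ?m"] by simp
    qed
    finally show False
      using lookup_white_monom_diag[OF d(1)[OF T(1)]] d(2)[OF T(1)] T(2) by simp
  qed
  then have "lin_indep_family ?f (cross_sets K L)"
    unfolding lin_indep_family_iff[OF fin] by blast
  with assms show ?thesis by simp
qed

end
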